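(* Let $C$ be a nonempty closed convex subset of a finite-dimensional real normed space $X$. Then $C$ has the strong separation property if and only if $\operatorname{bar}(C)=\operatorname{int}\operatorname{bar}(C)\cup\{0\}$. Furthermore, if $C$ is unbounded and $C$ has the strong separation property, then $\operatorname{int}C$ is nonempty.
   Context: The barrier cone of $C$ is $\operatorname{bar}(C)=\{x^*\in X^*: \sup_{c\in C}\langle x^*,c\rangle<+\infty\}$; $\operatorname{int}$ denotes interior in the norm topology. Convex sets $C,D\subset X$ are strongly separated if there exists $x^*\in X^*\setminus\{0\}$ with $\sup_{c\in C}\langle x^*,c\rangle<\inf_{d\in D}\langle x^*,d\rangle$. A convex set $C$ has the strong separation property if it is strongly separated from every nonempty closed convex subset $D$ of $X$ disjoint from $C$. *)

theory Defs
  imports "HOL-Analysis.Analysis"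
begin

text \<open>
  The dual of a real normed space \<open>'a\<close> is the space \<open>'a \<Rightarrow>\<^sub>L real\<close> of bounded linear functionals
  with the operator norm; suprema and infima are taken in the extended reals, so that they
  exist for unbounded sets.
\<close>

definition barrier_cone :: "'a::real_normed_vector set \<Rightarrow> ('a \<Rightarrow>\<^sub>L real) set"
  where "barrier_cone C = {f. (SUP c\<in>C. ereal (blinfun_apply f c)) < \<infinity>}"

definition strongly_separated :: "'a::real_normed_vector set \<Rightarrow> 'a set \<Rightarrow> bool"
  where "strongly_separated C D \<longleftrightarrow>
    (\<exists>f::'a \<Rightarrow>\<^sub>L real. f \<noteq> 0 \<and>
      (SUP c\<in>C. ereal (blinfun_apply f c)) < (INF d\<in>D. ereal (blinfun_apply f d)))"

definition strong_separation_property :: "'a::real_normed_vector set \<Rightarrow> bool"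
  where "strong_separation_property C \<longleftrightarrow>
    (\<forall>D. D \<noteq> {} \<and> closed D \<and> convex D \<and> C \<inter> D = {} \<longrightarrow> strongly_separated C D)"

end

theory Submission
  imports Defs
begin

text \<open>
  Both properties are governed by the directions \<open>u\<close> in which \<open>C\<close> goes to infinity: in finite
  dimension, a functional \<open>f\<close> is interior to the barrier cone iff \<open>f u < 0\<close> for every such \<open>u \<noteq> 0\<close>.
  For the last claim, take such a direction \<open>u\<close> and \<open>c \<in> C\<close>. A functional supporting \<open>C\<close> at \<open>c + u\<close>
  would satisfy \<open>f u \<ge> 0\<close>, so \<open>c + u\<close> is an interior point.
\<close>

text \<open>The space is known only to be spanned by a finite set, and its norm need not come from
  an inner product. Compactness of closed bounded sets is therefore derived by induction on a
  spanning set, and nearest points are taken for the form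
  \<open>\<Sum>f\<in>\<Phi>. f x * f y\<close> built from coordinate functionals. This form does
  three jobs: its minimisers separate, it yields a functional positive at a given nonzero vector,
  and it labels functionals by vectors, so that a limit of normalised separating functionals is
  found on the unit sphere of the space itself and cannot be 0.\<close>

section \<open>Suprema and infima replaced by real bounds\<close>

lemma barrier_cone_iff:
  "f \<in> barrier_cone C \<longleftrightarrow> (\<exists>M. \<forall>c\<in>C. blinfun_apply f c \<le> M)"
proof
  assume "f \<in> barrier_cone C"
  then have "(SUP c\<in>C. ereal (blinfun_apply f c)) < \<infinity>" by (simp add: barrier_cone_def)
  then obtain M where M: "(SUP c\<in>C. ereal (blinfun_apply f c)) < ereal M"
    using ereal_dense2 by blast
  have "blinfun_apply f c \<le> M" if "c \<in> C" for c
  proof -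
    have "ereal (blinfun_apply f c) \<le> (SUP c\<in>C. ereal (blinfun_apply f c))"
      using that by (rule SUP_upper)
    with M have "ereal (blinfun_apply f c) < ereal M" by (rule order_le_less_trans[rotated])
    then show ?thesis by simp
  qed
  then show "\<exists>M. \<forall>c\<in>C. blinfun_apply f c \<le> M" by blast
next
  assume "\<exists>M. \<forall>c\<in>C. blinfun_apply f c \<le> M"
  then obtain M where "\<forall>c\<in>C. blinfun_apply f c \<le> M" by blast
  then have "(SUP c\<in>C. ereal (blinfun_apply f c)) \<le> ereal M" by (intro SUP_least) auto
  also have "\<dots> < \<infinity>" by simp
  finally show "f \<in> barrier_cone C" by (simp add: barrier_cone_def)
qed

text \<open>Two reals fit strictly between the supremum and the infimum, even when one of these is
  infinite; this turns the condition into a real gap.\<close>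

lemma strongly_separated_iff:
  "strongly_separated C D \<longleftrightarrow>
    (\<exists>f a b. f \<noteq> 0 \<and> (a::real) < b \<and> (\<forall>c\<in>C. blinfun_apply f c \<le> a) \<and> (\<forall>d\<in>D. b \<le> blinfun_apply f d))"
proof
  assume "strongly_separated C D"
  then obtain f :: "'a \<Rightarrow>\<^sub>L real" where f: "f \<noteq> 0"
    "(SUP c\<in>C. ereal (blinfun_apply f c)) < (INF d\<in>D. ereal (blinfun_apply f d))"
    by (auto simp: strongly_separated_def)
  obtain a where a: "(SUP c\<in>C. ereal (blinfun_apply f c)) < ereal a"
    "ereal a < (INF d\<in>D. ereal (blinfun_apply f d))"
    using ereal_dense2[OF f(2)] by blast
  obtain b where b: "ereal a < ereal b" "ereal b < (INF d\<in>D. ereal (blinfun_apply f d))"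
    using ereal_dense2[OF a(2)] by blast
  have "blinfun_apply f c \<le> a" if "c \<in> C" for c
    using SUP_upper[OF that, of "\<lambda>c. ereal (blinfun_apply f c)"] a(1)
    by (metis ereal_less_eq(3) order_less_imp_le order_trans)
  moreover have "b \<le> blinfun_apply f d" if "d \<in> D" for d
    using INF_lower[OF that, of "\<lambda>c. ereal (blinfun_apply f c)"] b(2)
    by (metis ereal_less_eq(3) order_less_imp_le order_trans)
  ultimately show "\<exists>f a b. f \<noteq> 0 \<and> (a::real) < b \<and> (\<forall>c\<in>C. blinfun_apply f c \<le> a) \<and>
      (\<forall>d\<in>D. b \<le> blinfun_apply f d)"
    using f(1) b(1) by (intro exI[of _ f] exI[of _ a] exI[of _ b]) simp
next
  assume "\<exists>f a b. f \<noteq> 0 \<and> (a::real) < b \<and> (\<forall>c\<in>C. blinfun_apply f c \<le> a) \<and>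
      (\<forall>d\<in>D. b \<le> blinfun_apply f d)"
  then obtain f :: "'a \<Rightarrow>\<^sub>L real" and a b where f: "f \<noteq> 0" "a < b" "\<forall>c\<in>C. blinfun_apply f c \<le> a"
    "\<forall>d\<in>D. b \<le> blinfun_apply f d" by blast
  have "(SUP c\<in>C. ereal (blinfun_apply f c)) \<le> ereal a" using f by (intro SUP_least) auto
  also have "\<dots> < ereal b" using f by simp
  also have "\<dots> \<le> (INF d\<in>D. ereal (blinfun_apply f d))" using f by (intro INF_greatest) auto
  finally show "strongly_separated C D" using f(1) by (auto simp: strongly_separated_def)
qed

text \<open>A gap in the values of \<open>f\<close> forces a distance of at least the gap divided by
  the operator norm. Hence sets at distance 0 are never strongly separated, which is how the
  separation property is refuted later.\<close>

lemma strongly_separated_dist: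
  assumes "strongly_separated C D"
  obtains \<delta> where "\<delta> > 0" "\<And>c d. c \<in> C \<Longrightarrow> d \<in> D \<Longrightarrow> \<delta> \<le> norm (d - c)"
proof -
  obtain f :: "'a \<Rightarrow>\<^sub>L real" and a b where f: "f \<noteq> 0" "a < b" "\<forall>c\<in>C. blinfun_apply f c \<le> a"
    "\<forall>d\<in>D. b \<le> blinfun_apply f d" using assms unfolding strongly_separated_iff by blast
  show thesis
  proof
    show "(b - a) / norm f > 0" using f by simp
    fix c d assume "c \<in> C" "d \<in> D"
    then have "b - a \<le> blinfun_apply f d - blinfun_apply f c" using f by force
    also have "\<dots> = blinfun_apply f (d - c)" by (simp add: blinfun.diff_right)
    also have "\<dots> \<le> norm f * norm (d - c)" using norm_blinfun[of f "d - c"] by simp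
    finally show "(b - a) / norm f \<le> norm (d - c)" using f(1)
      by (simp add: divide_le_eq mult.commute)
  qed
qed

section \<open>Compactness in a finite-dimensional normed space\<close>

text \<open>\<open>d\<close> is the radius of a ball around \<open>b\<close> that misses
  \<open>S\<close>; dividing by \<open>t\<close> reduces to \<open>t = 1\<close>. The estimate
  controls the coefficient of \<open>b\<close> by the norm of the whole vector, which makes
  coordinates continuous.\<close>

lemma norm_scaleR_add_subspace_ge:
  fixes b :: "'a::real_normed_vector"
  assumes "subspace S" "closed S" "b \<notin> S"
  obtains d where "d > 0" "\<And>t s. s \<in> S \<Longrightarrow> \<bar>t\<bar> * d \<le> norm (t *\<^sub>R b + s)"
proof -
  have "open (- S)" using assms by (simp add: open_Compl)
  then obtain d where d: "d > 0" "ball b d \<subseteq> - S" using assms(3) by (auto simp: open_contains_ball)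
  have "\<bar>t\<bar> * d \<le> norm (t *\<^sub>R b + s)" if s: "s \<in> S" for t s
  proof (cases "t = 0")
    case False
    have "- (1 / t) *\<^sub>R s \<in> S" using assms(1) s by (simp add: subspace_scale subspace_neg)
    then have "- (1 / t) *\<^sub>R s \<notin> ball b d" using d by blast
    then have "d \<le> norm (b + (1 / t) *\<^sub>R s)" by (simp add: dist_norm)
    then have "\<bar>t\<bar> * d \<le> \<bar>t\<bar> * norm (b + (1 / t) *\<^sub>R s)" by (simp add: mult_left_mono)
    also have "\<dots> = norm (t *\<^sub>R (b + (1 / t) *\<^sub>R s))" by simp
    also have "t *\<^sub>R (b + (1 / t) *\<^sub>R s) = t *\<^sub>R b + s" using False by (simp add: scaleR_add_right)
    finally show ?thesis .
  qed simp
  with d(1) that show thesis by blast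
qed

lemma closed_if_compact_Int_cball:
  fixes S :: "'a::real_normed_vector set"
  assumes "\<And>r. compact (S \<inter> cball 0 r)"
  shows "closed S"
  unfolding closed_sequential_limits
proof (intro allI impI, elim conjE)
  fix x l assume x: "\<forall>n. x n \<in> S" and l: "x \<longlonglongrightarrow> l"
  obtain K where K: "\<And>n. norm (x n) \<le> K"
    using convergent_imp_bounded[OF l] by (auto simp: bounded_iff)
  have "closed (S \<inter> cball 0 K)" using assms compact_imp_closed by blast
  then have "l \<in> S \<inter> cball 0 K" using x K l
    unfolding closed_sequential_limits by (metis IntI mem_cball_0)
  then show "l \<in> S" by blast
qed

lemma compact_span_Int_cball:
  fixes S :: "'a::real_normed_vector set"
  assumes "finite S"
  shows "compact (span S \<inter> cball 0 r)"
  using assms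
proof (induction S arbitrary: r rule: finite_induct)
  case empty
  then show ?case by (simp add: compact_Int_closed)
next
  case (insert b S)
  show ?case
  proof (cases "b \<in> span S")
    case True
    then show ?thesis using insert.IH by (simp add: span_redundant)
  next
    case False
    \<comment> \<open>Closedness uses the sections of every radius, so the induction runs over all
      \<open>r\<close> at once.\<close>
    have cl: "closed (span S)" using insert.IH by (rule closed_if_compact_Int_cball)
    obtain d where d: "d > 0" "\<And>t s. s \<in> span S \<Longrightarrow> \<bar>t\<bar> * d \<le> norm (t *\<^sub>R b + s)"
      using norm_scaleR_add_subspace_ge[OF subspace_span cl False] by blast
    \<comment> \<open>The range of \<open>t\<close> comes from
      \<open>\<bar>t\<bar> * d \<le> norm x \<le> r\<close>, the radius for \<open>s\<close> from
      the triangle inequality for \<open>x - t *\<^sub>R b\<close>. The image covers the section but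
      may exceed it, hence the later intersection with the ball.\<close>
    define P where "P = (\<lambda>(t, s). t *\<^sub>R b + s) `
        ({- (r / d)..r / d} \<times> (span S \<inter> cball 0 (r + r / d * norm b)))"
    have "compact P" unfolding P_def
      by (intro compact_continuous_image compact_Times compact_Icc insert.IH)
         (auto intro!: continuous_intros simp: case_prod_unfold)
    moreover have "span (insert b S) \<inter> cball 0 r = P \<inter> cball 0 r"
    proof (intro equalityI subsetI)
      fix x assume x: "x \<in> span (insert b S) \<inter> cball 0 r"
      then obtain t where t: "x - t *\<^sub>R b \<in> span S" by (auto simp: span_insert)
      have "\<bar>t\<bar> * d \<le> norm x" using d(2)[OF t, of t] by simp
      then have "\<bar>t\<bar> * d \<le> r" using x by simp
      then have td: "\<bar>t\<bar> \<le> r / d" using d(1) by (simp add: le_divide_eq)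
      have "norm (x - t *\<^sub>R b) \<le> norm x + \<bar>t\<bar> * norm b" using norm_triangle_ineq4[of x "t *\<^sub>R b"] by simp
      also have "\<dots> \<le> r + r / d * norm b" using x td by (intro add_mono mult_right_mono) auto
      finally have "(t, x - t *\<^sub>R b) \<in> {- (r / d)..r / d} \<times> (span S \<inter> cball 0 (r + r / d * norm b))"
        using t td by auto
      then show "x \<in> P \<inter> cball 0 r" using x unfolding P_def by (force simp: image_iff)
    next
      fix x assume x: "x \<in> P \<inter> cball 0 r"
      then obtain t s where s: "s \<in> span S" "x = t *\<^sub>R b + s" unfolding P_def by auto
      then have "x - t *\<^sub>R b \<in> span S" by simp
      then have "x \<in> span (insert b S)" unfolding span_insert by blast
      then show "x \<in> span (insert b S) \<inter> cball 0 r" using x by blast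
    qed
    ultimately show ?thesis by (simp add: compact_Int_closed)
  qed
qed

lemma compact_if_span_finite:
  fixes K :: "'a::real_normed_vector set"
  assumes "finite B" "span B = (UNIV :: 'a set)" "closed K" "bounded K"
  shows "compact K"
proof -
  obtain r where "K \<subseteq> cball 0 r"
    using assms(4) by (auto simp: bounded_iff subset_iff)
  then have "K = (span B \<inter> cball 0 r) \<inter> K" using assms(2) by auto
  then show ?thesis using compact_span_Int_cball[OF assms(1)] assms(3) by (metis compact_Int_closed)
qed

section \<open>A Gram form in place of an inner product\<close>

text \<open>Instead of a basis, only the control of the norm by finitely many values is recorded: it
  makes the form below definite and its sublevel sets bounded.\<close>

definition coordinates :: "('a::real_normed_vector \<Rightarrow>\<^sub>L real) set \<Rightarrow> bool"
  where "coordinates \<Phi> \<longleftrightarrow>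
    finite \<Phi> \<and> (\<exists>c. \<forall>x. norm x \<le> c * (\<Sum>f\<in>\<Phi>. \<bar>blinfun_apply f x\<bar>))"

text \<open>The coordinates with respect to a maximal independent subset serve. Each is bounded
  because \<open>b\<close> has positive distance from the span of the other basis vectors, which is
  closed.\<close>

lemma ex_coordinates:
  assumes "finite B" "span B = (UNIV :: 'a::real_normed_vector set)"
  shows "\<exists>\<Phi> :: ('a \<Rightarrow>\<^sub>L real) set. coordinates \<Phi>"
proof -
  obtain A where A: "A \<subseteq> B" "independent A" "B \<subseteq> span A"
    using maximal_independent_subset by blast
  have spA: "span A = UNIV" using A(3) assms(2) by (metis span_mono span_span top.extremum_uniqueI)
  have fA: "finite A" using A(1) assms(1) finite_subset by blast
  let ?r = "\<lambda>b x. representation A x b"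
  have bl: "bounded_linear (?r b)" if b: "b \<in> A" for b
  proof -
    have "b \<notin> span (A - {b})" using A(2) b by (simp add: dependent_def)
    moreover have "closed (span (A - {b}))"
      using fA by (intro closed_if_compact_Int_cball compact_span_Int_cball) simp
    ultimately obtain d where d: "d > 0"
      "\<And>t s. s \<in> span (A - {b}) \<Longrightarrow> \<bar>t\<bar> * d \<le> norm (t *\<^sub>R b + s)"
      using norm_scaleR_add_subspace_ge[OF subspace_span] by blast
    show ?thesis
    proof (rule bounded_linear_intro)
      show "?r b (x + y) = ?r b x + ?r b y" for x y
        by (simp add: representation_add A(2) spA)
      show "?r b (s *\<^sub>R x) = s *\<^sub>R ?r b x" for s x
        by (simp add: representation_scale A(2) spA)
      show "norm (?r b x) \<le> norm x * (1 / d)" for x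
      proof -
        have "x = (\<Sum>a\<in>A. ?r a x *\<^sub>R a)"
          using sum_representation_eq[OF A(2), of x A] fA spA by simp
        also have "\<dots> = ?r b x *\<^sub>R b + (\<Sum>a\<in>A - {b}. ?r a x *\<^sub>R a)"
          using fA b by (simp add: sum.remove)
        finally have x: "x = ?r b x *\<^sub>R b + (\<Sum>a\<in>A - {b}. ?r a x *\<^sub>R a)" .
        have "(\<Sum>a\<in>A - {b}. ?r a x *\<^sub>R a) \<in> span (A - {b})"
          by (intro span_sum span_scale span_base) auto
        from d(2)[OF this, of "?r b x"] show ?thesis using d(1) x[symmetric]
          by (simp add: le_divide_eq)
      qed
    qed
  qed
  define F where "F = (\<lambda>b. Blinfun (?r b))"
  have F: "blinfun_apply (F b) x = ?r b x" if "b \<in> A" for b x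
    unfolding F_def using bl[OF that] by (simp add: bounded_linear_Blinfun_apply)
  define c where "c = (\<Sum>b\<in>A. norm b)"
  have "norm x \<le> c * (\<Sum>f\<in>F ` A. \<bar>blinfun_apply f x\<bar>)" for x
  proof -
    have "norm x = norm (\<Sum>a\<in>A. ?r a x *\<^sub>R a)"
      using sum_representation_eq[OF A(2), of x A] fA spA by simp
    also have "\<dots> \<le> (\<Sum>a\<in>A. \<bar>?r a x\<bar> * norm a)" by (rule sum_norm_le) simp
    also have "\<dots> \<le> (\<Sum>a\<in>A. (\<Sum>f\<in>F ` A. \<bar>blinfun_apply f x\<bar>) * norm a)"
    proof (intro sum_mono mult_right_mono)
      fix a assume a: "a \<in> A"
      have "\<bar>blinfun_apply (F a) x\<bar> \<le> (\<Sum>f\<in>F ` A. \<bar>blinfun_apply f x\<bar>)"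
        using a fA by (intro member_le_sum) auto
      then show "\<bar>?r a x\<bar> \<le> (\<Sum>f\<in>F ` A. \<bar>blinfun_apply f x\<bar>)" using F[OF a] by simp
    qed simp
    also have "\<dots> = c * (\<Sum>f\<in>F ` A. \<bar>blinfun_apply f x\<bar>)"
      unfolding c_def by (subst sum_distrib_left[symmetric]) (rule mult.commute)
    finally show ?thesis .
  qed
  then show ?thesis unfolding coordinates_def using fA by blast
qed

text \<open>The Riesz map of the symmetric form \<open>\<Sum>f\<in>\<Phi>. f x * f y\<close>, which
  is an inner product once \<open>\<Phi>\<close> satisfies \<open>coordinates\<close>.\<close>

definition gram :: "('a::real_normed_vector \<Rightarrow>\<^sub>L real) set \<Rightarrow> 'a \<Rightarrow> 'a \<Rightarrow>\<^sub>L real"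
  where "gram \<Phi> y = (\<Sum>f\<in>\<Phi>. blinfun_apply f y *\<^sub>R f)"

lemma gram_apply:
  "blinfun_apply (gram \<Phi> y) x = (\<Sum>f\<in>\<Phi>. blinfun_apply f y * blinfun_apply f x)"
  by (simp add: gram_def blinfun.sum_left blinfun.scaleR_left)

lemma gram_scaleR: "gram \<Phi> (t *\<^sub>R y) = t *\<^sub>R gram \<Phi> y"
  by (simp add: gram_def blinfun.scaleR_right scaleR_sum_right)

lemma tendsto_gram: "(y \<longlongrightarrow> l) F \<Longrightarrow> ((\<lambda>n. gram \<Phi> (y n)) \<longlongrightarrow> gram \<Phi> l) F"
  unfolding gram_def by (intro tendsto_intros)

lemma gram_nonneg: "0 \<le> blinfun_apply (gram \<Phi> x) x"
  by (simp add: gram_apply sum_nonneg)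

lemma gram_pos:
  assumes "coordinates \<Phi>" "x \<noteq> 0"
  shows "0 < blinfun_apply (gram \<Phi> x) x"
proof (rule ccontr)
  assume "\<not> 0 < blinfun_apply (gram \<Phi> x) x"
  then have "(\<Sum>f\<in>\<Phi>. blinfun_apply f x * blinfun_apply f x) = 0"
    using gram_nonneg[of \<Phi> x] by (simp add: gram_apply)
  then have "\<forall>f\<in>\<Phi>. blinfun_apply f x = 0"
    using assms(1) by (simp add: sum_nonneg_eq_0_iff coordinates_def)
  moreover obtain c where "norm x \<le> c * (\<Sum>f\<in>\<Phi>. \<bar>blinfun_apply f x\<bar>)"
    using assms(1) unfolding coordinates_def by blast
  ultimately show False using assms(2) by simp
qed

text \<open>The inequality \<open>\<bar>t\<bar> \<le> 1 + t * t\<close> trades the absolute values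
  that control the norm for squares. This coercivity provides minimisers on closed sets.\<close>

lemma bounded_gram_le:
  assumes "coordinates \<Phi>"
  shows "bounded {x. blinfun_apply (gram \<Phi> x) x \<le> M}"
proof -
  obtain c where c: "\<And>x. norm x \<le> c * (\<Sum>f\<in>\<Phi>. \<bar>blinfun_apply f x\<bar>)"
    using assms unfolding coordinates_def by blast
  have "norm x \<le> \<bar>c\<bar> * (of_nat (card \<Phi>) + M)" if "blinfun_apply (gram \<Phi> x) x \<le> M" for x
  proof -
    have *: "\<bar>t\<bar> \<le> 1 + t * t" for t :: real
    proof -
      have "0 \<le> (\<bar>t\<bar> - 1 / 2)\<^sup>2" by simp
      then show ?thesis by (simp add: power2_eq_square algebra_simps abs_mult_self_eq)
    qed
    have "norm x \<le> c * (\<Sum>f\<in>\<Phi>. \<bar>blinfun_apply f x\<bar>)" by (rule c)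
    also have "\<dots> \<le> \<bar>c\<bar> * (\<Sum>f\<in>\<Phi>. \<bar>blinfun_apply f x\<bar>)"
      by (intro mult_right_mono sum_nonneg) auto
    also have "\<dots> \<le> \<bar>c\<bar> * (\<Sum>f\<in>\<Phi>. 1 + blinfun_apply f x * blinfun_apply f x)"
      by (intro mult_left_mono sum_mono *) auto
    also have "\<dots> \<le> \<bar>c\<bar> * (of_nat (card \<Phi>) + M)"
      using that by (intro mult_left_mono) (auto simp: sum.distrib gram_apply)
    finally show ?thesis .
  qed
  then show ?thesis by (auto simp: bounded_iff)
qed

section \<open>Separating and supporting functionals\<close>

text \<open>The separating functional is the gradient of the Gram form at its minimiser on \<open>K\<close>.\<close>

lemma separate_zero:
  fixes K :: "'a::real_normed_vector set"
  assumes fd: "finite B" "span B = (UNIV :: 'a set)" and \<Phi>: "coordinates \<Phi>"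
    and K: "closed K" "convex K" "K \<noteq> {}" "0 \<notin> K"
  obtains y m where "m > 0" "\<And>k. k \<in> K \<Longrightarrow> m \<le> blinfun_apply (gram \<Phi> y) k"
proof -
  let ?q = "\<lambda>x. blinfun_apply (gram \<Phi> x) x"
  obtain k1 where k1: "k1 \<in> K" using K(3) by blast
  have cont: "continuous_on UNIV ?q" unfolding gram_apply by (intro continuous_intros)
  \<comment> \<open>\<open>K\<close> may be unbounded; cutting at the level of one of its points
    keeps the minimum and leaves a compact set.\<close>
  define L where "L = K \<inter> {x. ?q x \<le> ?q k1}"
  have "closed {x. ?q x \<le> ?q k1}" using cont by (intro closed_Collect_le continuous_on_const)
  then have "closed L" unfolding L_def using K(1) by (rule closed_Int[rotated])
  moreover have "bounded L" unfolding L_def using bounded_gram_le[OF \<Phi>] by (rule bounded_subset) blast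
  ultimately have "compact L" by (rule compact_if_span_finite[OF fd])
  moreover have "L \<noteq> {}" using k1 unfolding L_def by blast
  ultimately obtain y where y: "y \<in> L" "\<And>x. x \<in> L \<Longrightarrow> ?q y \<le> ?q x"
    using continuous_attains_inf[of L ?q] continuous_on_subset[OF cont] by blast
  have yK: "y \<in> K" using y(1) by (simp add: L_def)
  have min: "?q y \<le> ?q x" if "x \<in> K" for x
    using y(2)[of x] y(2)[of k1] k1 that unfolding L_def by force
  have "?q y \<le> blinfun_apply (gram \<Phi> y) k" if k: "k \<in> K" for k
  proof -
    define a where "a = blinfun_apply (gram \<Phi> y) (k - y)"
    define e where "e = ?q (k - y)"
    have e0: "e \<ge> 0" unfolding e_def by (rule gram_nonneg)
    \<comment> \<open>Minimality along the segment from \<open>y\<close> to \<open>k\<close>,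
      expanded in \<open>t\<close> and divided by \<open>t\<close>.\<close>
    have ineq: "0 \<le> 2 * a + t * e" if t: "0 < t" "t \<le> 1" for t
    proof -
      have "(1 - t) *\<^sub>R y + t *\<^sub>R k \<in> K" using K(2) yK k t by (intro convexD) auto
      then have "?q y \<le> ?q ((1 - t) *\<^sub>R y + t *\<^sub>R k)" by (rule min)
      also have "(1 - t) *\<^sub>R y + t *\<^sub>R k = y + t *\<^sub>R (k - y)" by (simp add: algebra_simps)
      also have "?q (y + t *\<^sub>R (k - y)) = ?q y + t * (2 * a + t * e)"
        unfolding a_def e_def gram_apply blinfun.add_right blinfun.scaleR_right
        by (simp add: sum_distrib_left flip: sum.distrib) (rule sum.cong, auto simp: algebra_simps)
      finally have "0 \<le> t * (2 * a + t * e)" by simp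
      then show ?thesis using t by (simp add: zero_le_mult_iff)
    qed
    have "a \<ge> 0"
    proof (rule ccontr)
      assume a: "\<not> a \<ge> 0"
      \<comment> \<open>Small enough that \<open>t * e \<le> - a\<close>, so that
        \<open>2 * a + t * e \<le> a < 0\<close>; the \<open>+ 1\<close> covers
        \<open>e = 0\<close>.\<close>
      define t where "t = min 1 (- a / (e + 1))"
      have t: "0 < t" "t \<le> 1" using a e0 by (auto simp: t_def intro: divide_neg_pos)
      have "t * e \<le> - a / (e + 1) * e" using e0 by (intro mult_right_mono) (auto simp: t_def)
      also have "\<dots> = (- a) * (e / (e + 1))" by simp
      also have "\<dots> \<le> (- a) * 1" using a e0 by (intro mult_left_mono) auto
      finally show False using ineq[OF t] a by linarith
    qed
    then show ?thesis by (simp add: a_def blinfun.diff_right)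
  qed
  moreover have "?q y > 0" using gram_pos[OF \<Phi>] yK K(4) by metis
  ultimately show thesis using that by blast
qed

text \<open>The gaps may shrink to 0 along the sequence, so only a weak inequality survives.
  Normalising the vectors \<open>y n\<close> rather than the functionals gives a limit
  \<open>z\<close> on the compact unit sphere, and \<open>gram \<Phi> z\<close> is nonzero because
  the form is definite.\<close>

lemma separate_zero_seq:
  fixes K :: "nat \<Rightarrow> 'a::real_normed_vector set"
  assumes fd: "finite B" "span B = (UNIV :: 'a set)"
    and K: "\<And>n. closed (K n)" "\<And>n. convex (K n)" "\<And>n. K n \<noteq> {}" "\<And>n. 0 \<notin> K n"
  obtains f :: "'a \<Rightarrow>\<^sub>L real" where "f \<noteq> 0"
    "\<And>k l. k \<longlonglongrightarrow> l \<Longrightarrow> eventually (\<lambda>n. k n \<in> K n) sequentially \<Longrightarrow> 0 \<le> blinfun_apply f l"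
proof -
  obtain \<Phi> :: "('a \<Rightarrow>\<^sub>L real) set" where \<Phi>: "coordinates \<Phi>" using ex_coordinates[OF fd] by blast
  have "\<exists>y. norm y = 1 \<and> (\<forall>k\<in>K n. 0 \<le> blinfun_apply (gram \<Phi> y) k)" for n
  proof -
    obtain y m where ym: "m > 0" "\<And>k. k \<in> K n \<Longrightarrow> m \<le> blinfun_apply (gram \<Phi> y) k"
      using separate_zero[OF fd \<Phi> K(1) K(2) K(3) K(4)] by blast
    obtain k where "k \<in> K n" using K(3) by blast
    then have "y \<noteq> 0" using ym(1) ym(2)[of k] by (auto simp: gram_apply)
    moreover have "0 \<le> blinfun_apply (gram \<Phi> ((1 / norm y) *\<^sub>R y)) k" if "k \<in> K n" for k
      using ym(1) ym(2)[OF that] by (simp add: gram_scaleR blinfun.scaleR_left)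
    ultimately show ?thesis by (intro exI[of _ "(1 / norm y) *\<^sub>R y"]) auto
  qed
  then obtain y where y: "\<And>n. norm (y n) = 1" "\<And>n k. k \<in> K n \<Longrightarrow> 0 \<le> blinfun_apply (gram \<Phi> (y n)) k"
    by metis
  have "closed {x::'a. norm x = 1}" by (intro closed_Collect_eq continuous_intros)
  moreover have "bounded {x::'a. norm x = 1}" by (auto simp: bounded_iff)
  ultimately have "compact {x::'a. norm x = 1}" by (rule compact_if_span_finite[OF fd])
  moreover have "\<forall>n. y n \<in> {x. norm x = 1}" using y(1) by simp
  ultimately obtain z r where z: "z \<in> {x. norm x = 1}" "strict_mono r" "(y \<circ> r) \<longlonglongrightarrow> z"
    unfolding compact_def by metis
  show thesis
  proof
    have "z \<noteq> 0" using z(1) by auto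
    then show "gram \<Phi> z \<noteq> 0" using gram_pos[OF \<Phi>] by fastforce
    fix k l assume k: "k \<longlonglongrightarrow> l" "eventually (\<lambda>n. k n \<in> K n) sequentially"
    have "(\<lambda>n. blinfun_apply (gram \<Phi> ((y \<circ> r) n)) ((k \<circ> r) n)) \<longlonglongrightarrow> blinfun_apply (gram \<Phi> z) l"
      using tendsto_gram[OF z(3)] LIMSEQ_subseq_LIMSEQ[OF k(1) z(2)] by (rule blinfun.tendsto)
    moreover have "eventually (\<lambda>n. 0 \<le> blinfun_apply (gram \<Phi> ((y \<circ> r) n)) ((k \<circ> r) n)) sequentially"
      using eventually_subseq[OF z(2) k(2)] by eventually_elim (simp add: y(2))
    ultimately show "0 \<le> blinfun_apply (gram \<Phi> z) l"
      by (rule tendsto_lowerbound) simp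
  qed
qed

text \<open>The differences \<open>d - c\<close> avoid \<open>ball 0 \<delta>\<close>, hence so does
  their closure. Separating 0 from that closed convex set leaves the gap \<open>m\<close> between
  the values on \<open>C\<close> and on \<open>D\<close>.\<close>

lemma strongly_separated_if_dist:
  fixes C D :: "'a::real_normed_vector set"
  assumes fd: "finite B" "span B = (UNIV :: 'a set)"
    and C: "C \<noteq> {}" "convex C" and D: "D \<noteq> {}" "convex D"
    and \<delta>: "\<delta> > 0" "\<And>c d. c \<in> C \<Longrightarrow> d \<in> D \<Longrightarrow> \<delta> \<le> norm (d - c)"
  shows "strongly_separated C D"
proof -
  obtain \<Phi> :: "('a \<Rightarrow>\<^sub>L real) set" where \<Phi>: "coordinates \<Phi>" using ex_coordinates[OF fd] by blast
  define E where "E = (\<Union>x\<in>D. \<Union>y\<in>C. {x - y})"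
  have "closure E \<subseteq> - ball 0 \<delta>"
  proof (rule closure_minimal)
    show "E \<subseteq> - ball 0 \<delta>"
      using \<delta>(2) by (fastforce simp: E_def simp flip: not_le)
  qed (simp add: closed_Compl)
  then have "0 \<notin> closure E" using \<delta>(1) by auto
  moreover have "convex (closure E)"
    unfolding E_def using C(2) D(2) by (intro convex_closure convex_differences)
  moreover have "E \<noteq> {}" using C(1) D(1) by (simp add: E_def)
  then have "closure E \<noteq> {}" by simp
  ultimately obtain y m where ym: "m > 0" "\<And>k. k \<in> closure E \<Longrightarrow> m \<le> blinfun_apply (gram \<Phi> y) k"
    using separate_zero[OF fd \<Phi> closed_closure] by blast
  define f where "f = gram \<Phi> y"
  have gap: "blinfun_apply f c + m \<le> blinfun_apply f d" if "c \<in> C" "d \<in> D" for c d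
  proof -
    have "d - c \<in> E" using that by (auto simp: E_def)
    then have "d - c \<in> closure E" using closure_subset by blast
    from ym(2)[OF this] show ?thesis by (simp add: f_def blinfun.diff_right)
  qed
  obtain c0 d0 where c0: "c0 \<in> C" and d0: "d0 \<in> D" using C D by blast
  have "f \<noteq> 0" using gap[OF c0 d0] ym(1) by auto
  moreover have bdd: "bdd_above (blinfun_apply f ` C)"
    using gap[OF _ d0] ym(1) by (intro bdd_aboveI[of _ "blinfun_apply f d0"]) force
  moreover have "blinfun_apply f c \<le> Sup (blinfun_apply f ` C)" if "c \<in> C" for c
    using that bdd by (intro cSUP_upper)
  moreover have "Sup (blinfun_apply f ` C) + m \<le> blinfun_apply f d" if "d \<in> D" for d
  proof -
    have "Sup (blinfun_apply f ` C) \<le> blinfun_apply f d - m"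
      using C(1) gap[OF _ that] by (intro cSUP_least) (auto simp: le_diff_eq)
    then show ?thesis by simp
  qed
  ultimately show ?thesis unfolding strongly_separated_iff using ym(1)
    by (intro exI[of _ f] exI[of _ "Sup (blinfun_apply f ` C)"]
        exI[of _ "Sup (blinfun_apply f ` C) + m"]) auto
qed

text \<open>The set of differences \<open>d - c\<close> need not be closed and may have 0 in its
  closure. Cutting \<open>D\<close> to compact pieces makes the differences closed, and each fixed
  \<open>d - c\<close> lies in all late \<open>K n\<close>.\<close>

lemma weakly_separated:
  fixes C D :: "'a::real_normed_vector set"
  assumes fd: "finite B" "span B = (UNIV :: 'a set)"
    and C: "C \<noteq> {}" "closed C" "convex C" and D: "D \<noteq> {}" "closed D" "convex D"
    and disj: "C \<inter> D = {}"
  obtains f :: "'a \<Rightarrow>\<^sub>L real" where "f \<noteq> 0"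
    "\<And>c d. c \<in> C \<Longrightarrow> d \<in> D \<Longrightarrow> blinfun_apply f c \<le> blinfun_apply f d"
proof -
  obtain d0 where d0: "d0 \<in> D" using D by blast
  define K where "K = (\<lambda>n. \<Union>x\<in>D \<inter> cball d0 (real n). \<Union>y\<in>C. {x - y})"
  have "compact (D \<inter> cball d0 (real n))" for n
    using D(2) by (intro compact_if_span_finite[OF fd]) auto
  then have 1: "closed (K n)" for n unfolding K_def using C(2) by (rule compact_closed_differences)
  have 2: "convex (K n)" for n unfolding K_def using C(3) D(3)
    by (intro convex_differences convex_Int) auto
  have 3: "K n \<noteq> {}" for n using C(1) d0 by (auto simp: K_def)
  have 4: "0 \<notin> K n" for n using disj by (auto simp: K_def)
  obtain f :: "'a \<Rightarrow>\<^sub>L real" where f: "f \<noteq> 0"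
    "\<And>k l. k \<longlonglongrightarrow> l \<Longrightarrow> eventually (\<lambda>n. k n \<in> K n) sequentially \<Longrightarrow> 0 \<le> blinfun_apply f l"
    by (rule separate_zero_seq[OF fd 1 2 3 4]) (rule that)
  show thesis
  proof (rule that[OF f(1)])
    fix c d assume cd: "c \<in> C" "d \<in> D"
    have "eventually (\<lambda>n. dist d0 d \<le> real n) sequentially"
      using filterlim_real_sequentially by (auto simp: filterlim_at_top)
    then have "eventually (\<lambda>n. d - c \<in> K n) sequentially"
      by eventually_elim (use cd in \<open>auto simp: K_def\<close>)
    with f(2)[of "\<lambda>_. d - c" "d - c"] show "blinfun_apply f c \<le> blinfun_apply f d"
      by (simp add: blinfun.diff_right)
  qed
qed

text \<open>\<open>c\<close> is a limit of points \<open>z n\<close> outside \<open>C\<close>;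
  separating 0 from each translate \<open>z n - C\<close> and passing to the limit supports
  \<open>C\<close> at \<open>c\<close>.\<close>

lemma supporting_functional:
  fixes C :: "'a::real_normed_vector set"
  assumes fd: "finite B" "span B = (UNIV :: 'a set)"
    and C: "closed C" "convex C" and c: "c \<in> C" "c \<notin> interior C"
  obtains f :: "'a \<Rightarrow>\<^sub>L real" where "f \<noteq> 0"
    "\<And>x. x \<in> C \<Longrightarrow> blinfun_apply f x \<le> blinfun_apply f c"
proof -
  have "c \<in> closure (- C)" using c(2) by (simp add: closure_complement)
  then obtain z where z: "\<And>n. z n \<in> - C" "z \<longlonglongrightarrow> c" by (auto simp: closure_sequential)
  define K where "K = (\<lambda>n. \<Union>x\<in>{z n}. \<Union>y\<in>C. {x - y})"
  have 1: "closed (K n)" for n unfolding K_def using C(1) by (intro compact_closed_differences) auto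
  have 2: "convex (K n)" for n unfolding K_def using C(2)
    by (intro convex_differences) auto
  have 3: "K n \<noteq> {}" for n using c(1) by (auto simp: K_def)
  have 4: "0 \<notin> K n" for n using z(1)[of n] by (auto simp: K_def)
  obtain f :: "'a \<Rightarrow>\<^sub>L real" where f: "f \<noteq> 0"
    "\<And>k l. k \<longlonglongrightarrow> l \<Longrightarrow> eventually (\<lambda>n. k n \<in> K n) sequentially \<Longrightarrow> 0 \<le> blinfun_apply f l"
    by (rule separate_zero_seq[OF fd 1 2 3 4]) (rule that)
  show thesis
  proof (rule that[OF f(1)])
    fix x assume x: "x \<in> C"
    have "(\<lambda>n. z n - x) \<longlonglongrightarrow> c - x" using z(2) by (intro tendsto_intros)
    moreover have "eventually (\<lambda>n. z n - x \<in> K n) sequentially" using x by (auto simp: K_def)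
    ultimately show "blinfun_apply f x \<le> blinfun_apply f c"
      using f(2)[of "\<lambda>n. z n - x" "c - x"] by (simp add: blinfun.diff_right)
  qed
qed

section \<open>Asymptotic directions and the interior of the barrier cone\<close>

text \<open>For a nonempty closed convex set these are the unit vectors of its recession cone; the
  form with sequences is the one that compactness delivers.\<close>

definition asymptotic_direction :: "'a::real_normed_vector set \<Rightarrow> 'a \<Rightarrow> bool"
  where "asymptotic_direction C u \<longleftrightarrow> (\<exists>x. (\<forall>n. x n \<in> C) \<and>
    filterlim (\<lambda>n. norm (x n)) at_top sequentially \<and> (\<lambda>n. x n /\<^sub>R norm (x n)) \<longlonglongrightarrow> u)"

lemma ex_direction_subseq:
  fixes x :: "nat \<Rightarrow> 'a::real_normed_vector"
  assumes fd: "finite B" "span B = (UNIV :: 'a set)"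
    and x: "filterlim (\<lambda>n. norm (x n)) at_top sequentially"
  obtains r u where "strict_mono r" "norm u = 1"
    "filterlim (\<lambda>n. norm (x (r n))) at_top sequentially"
    "(\<lambda>n. x (r n) /\<^sub>R norm (x (r n))) \<longlonglongrightarrow> u"
proof -
  define v where "v = (\<lambda>n. x n /\<^sub>R norm (x n))"
  have "v n \<in> cball 0 1" for n by (cases "x n = 0") (auto simp: v_def)
  moreover have "compact (cball (0::'a) 1)" by (intro compact_if_span_finite[OF fd]) auto
  ultimately obtain u r where u: "strict_mono r" "(v \<circ> r) \<longlonglongrightarrow> u"
    unfolding compact_def by metis
  have xr: "filterlim (\<lambda>n. norm (x (r n))) at_top sequentially"
    using filterlim_compose[OF x filterlim_subseq[OF u(1)]] .
  \<comment> \<open>As \<open>inverse 0 = 0\<close>, the quotient is 0 at the zero vector; norm 1 is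
    certain only once the vectors are nonzero.\<close>
  then have "eventually (\<lambda>n. norm (x (r n)) \<ge> 1) sequentially" by (simp add: filterlim_at_top)
  then have "eventually (\<lambda>n. norm ((v \<circ> r) n) = 1) sequentially"
    by eventually_elim (subst o_apply, simp add: v_def, subst left_inverse, auto)
  then have "(\<lambda>n. norm ((v \<circ> r) n)) \<longlonglongrightarrow> 1" by (rule tendsto_eventually)
  with tendsto_norm[OF u(2)] have "norm u = 1" by (rule LIMSEQ_unique)
  moreover have "(\<lambda>n. x (r n) /\<^sub>R norm (x (r n))) \<longlonglongrightarrow> u"
    using u(2) by (simp add: v_def o_def)
  ultimately show thesis by (intro that[OF u(1) _ xr])
qed

text \<open>\<open>c + t *\<^sub>R u\<close> is a limit of points on the segments from
  \<open>c\<close> to \<open>x n\<close>, with weight \<open>t / norm (x n)\<close> on the far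
  end.\<close>

lemma asymptotic_direction_add_mem:
  assumes C: "closed C" "convex C" and u: "asymptotic_direction C u" and c: "c \<in> C" and t: "t \<ge> 0"
  shows "c + t *\<^sub>R u \<in> C"
proof -
  obtain x where x: "\<And>n. x n \<in> C" "filterlim (\<lambda>n. norm (x n)) at_top sequentially"
    "(\<lambda>n. x n /\<^sub>R norm (x n)) \<longlonglongrightarrow> u" using u by (auto simp: asymptotic_direction_def)
  have "(\<lambda>n. t / norm (x n)) \<longlonglongrightarrow> 0"
    using x(2) by (intro tendsto_divide_0[OF tendsto_const] filterlim_at_top_imp_at_infinity)
  then have "(\<lambda>n. (1 - t / norm (x n)) *\<^sub>R c + t *\<^sub>R (x n /\<^sub>R norm (x n))) \<longlonglongrightarrow> (1 - 0) *\<^sub>R c + t *\<^sub>R u"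
    using x(3) by (intro tendsto_intros)
  moreover have "eventually (\<lambda>n. norm (x n) \<ge> max 1 t) sequentially"
    using x(2) unfolding filterlim_at_top by blast
  then have "eventually (\<lambda>n. (1 - t / norm (x n)) *\<^sub>R c + t *\<^sub>R (x n /\<^sub>R norm (x n)) \<in> C) sequentially"
  proof eventually_elim
    case (elim n)
    then have "t / norm (x n) \<le> 1" by (auto simp: divide_le_eq)
    then have "(1 - t / norm (x n)) *\<^sub>R c + (t / norm (x n)) *\<^sub>R x n \<in> C"
      using C(2) c x(1) t by (intro convexD) auto
    then show ?case by (simp add: divide_inverse)
  qed
  ultimately have "(1 - 0) *\<^sub>R c + t *\<^sub>R u \<in> C"
    by (intro Lim_in_closed_set[OF C(1) _ sequentially_bot])
  then show ?thesis by simp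
qed

lemma barrier_cone_direction_le:
  assumes "asymptotic_direction C u" "f \<in> barrier_cone C"
  shows "blinfun_apply f u \<le> 0"
proof -
  obtain x where x: "\<And>n. x n \<in> C" "filterlim (\<lambda>n. norm (x n)) at_top sequentially"
    "(\<lambda>n. x n /\<^sub>R norm (x n)) \<longlonglongrightarrow> u" using assms(1) by (auto simp: asymptotic_direction_def)
  obtain M where M: "\<And>c. c \<in> C \<Longrightarrow> blinfun_apply f c \<le> M" using assms(2) by (auto simp: barrier_cone_iff)
  have "(\<lambda>n. M / norm (x n)) \<longlonglongrightarrow> 0"
    using x(2) by (intro tendsto_divide_0[OF tendsto_const] filterlim_at_top_imp_at_infinity)
  moreover have "(\<lambda>n. blinfun_apply f (x n /\<^sub>R norm (x n))) \<longlonglongrightarrow> blinfun_apply f u"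
    using x(3) by (intro tendsto_intros)
  moreover have "blinfun_apply f (x n /\<^sub>R norm (x n)) \<le> M / norm (x n)" for n
    using M[OF x(1), of n] by (simp add: blinfun.scaleR_right divide_inverse mult.commute[of "inverse _"] mult_right_mono)
  ultimately show ?thesis by (meson LIMSEQ_le)
qed

text \<open>Strictness comes from room to perturb: adding to \<open>f\<close> a functional of norm
  \<open>e / 2\<close> that is positive at \<open>u\<close> stays in the barrier cone, whose members
  are at most 0 at \<open>u\<close>.\<close>

lemma interior_barrier_cone_direction_less:
  fixes C :: "'a::real_normed_vector set"
  assumes fd: "finite B" "span B = (UNIV :: 'a set)"
    and u: "asymptotic_direction C u" "u \<noteq> 0" and f: "f \<in> interior (barrier_cone C)"
  shows "blinfun_apply f u < 0"
proof -
  obtain \<Phi> :: "('a \<Rightarrow>\<^sub>L real) set" where \<Phi>: "coordinates \<Phi>" using ex_coordinates[OF fd] by blast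
  define g where "g = gram \<Phi> u"
  have g: "blinfun_apply g u > 0" unfolding g_def by (rule gram_pos[OF \<Phi> u(2)])
  then have g0: "g \<noteq> 0" by auto
  obtain e where e: "e > 0" "ball f e \<subseteq> barrier_cone C" using f by (auto simp: mem_interior)
  have "f + (e / (2 * norm g)) *\<^sub>R g \<in> barrier_cone C"
    using e g0 by (intro subsetD[OF e(2)]) (simp add: dist_norm)
  from barrier_cone_direction_le[OF u(1) this]
  have "blinfun_apply f u + e / (2 * norm g) * blinfun_apply g u \<le> 0"
    by (simp add: blinfun.add_left blinfun.scaleR_left)
  moreover have "e / (2 * norm g) * blinfun_apply g u > 0" using e g g0 by simp
  ultimately show ?thesis by linarith
qed

text \<open>Functionals \<open>g n\<close> outside the barrier cone approach \<open>f\<close>, and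
  each exceeds \<open>n\<close> at some \<open>x n\<close> in \<open>C\<close>. As the norms of the
  \<open>g n\<close> stay bounded, the \<open>x n\<close> escape to infinity, and the positive
  values pass to the limit direction.\<close>

lemma not_interior_barrier_cone_direction:
  fixes C :: "'a::real_normed_vector set"
  assumes fd: "finite B" "span B = (UNIV :: 'a set)" and f: "f \<notin> interior (barrier_cone C)"
  obtains u where "asymptotic_direction C u" "u \<noteq> 0" "0 \<le> blinfun_apply f u"
proof -
  have "\<exists>g. dist f g < 1 / (real n + 1) \<and> g \<notin> barrier_cone C" for n
    using f[unfolded mem_interior, simplified, rule_format, of "1 / (real n + 1)"] by (auto simp: subset_iff)
  then obtain g where g: "\<And>n. dist f (g n) < 1 / (real n + 1)" "\<And>n. g n \<notin> barrier_cone C"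
    by metis
  have "\<exists>x\<in>C. blinfun_apply (g n) x > real n" for n
    using g(2)[of n] by (auto simp: barrier_cone_iff not_le)
  then obtain x where x: "\<And>n. x n \<in> C" "\<And>n. blinfun_apply (g n) (x n) > real n" by metis
  have "(\<lambda>n. 1 / (real n + 1)) \<longlonglongrightarrow> 0"
    using LIMSEQ_inverse_real_of_nat by (simp add: inverse_eq_divide add.commute)
  moreover have "norm (g n - f) \<le> 1 / (real n + 1)" for n
    using g(1)[of n] by (simp add: dist_norm norm_minus_commute)
  ultimately have "(\<lambda>n. g n - f) \<longlonglongrightarrow> 0"
    by (intro Lim_null_comparison[of "\<lambda>n. g n - f" "\<lambda>n. 1 / (real n + 1)"]) auto
  then have glim: "g \<longlonglongrightarrow> f" by (rule LIM_zero_cancel)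
  have xn: "norm (x n) \<ge> real n / (norm f + 1)" for n
  proof -
    have "norm (g n) \<le> norm f + 1"
      using g(1)[of n] norm_triangle_ineq2[of "g n" f]
      by (simp add: dist_norm norm_minus_commute) (smt (verit) divide_le_eq_1 of_nat_0_le_iff)
    then have "norm (g n) * norm (x n) \<le> (norm f + 1) * norm (x n)" by (intro mult_right_mono) auto
    then have "real n \<le> (norm f + 1) * norm (x n)" using x(2)[of n] norm_blinfun[of "g n" "x n"] by simp
    moreover have "norm f + 1 > 0" by (simp add: add_nonneg_pos)
    ultimately show ?thesis by (simp add: divide_le_eq mult.commute)
  qed
  have "norm f + 1 > 0" by (simp add: add_nonneg_pos)
  then have "filterlim (\<lambda>n. real n / (norm f + 1)) at_top sequentially"
    unfolding divide_inverse
    by (intro filterlim_at_top_mult_tendsto_pos[OF tendsto_const] filterlim_real_sequentially) auto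
  then have xlim: "filterlim (\<lambda>n. norm (x n)) at_top sequentially"
    by (rule filterlim_at_top_mono) (simp add: xn)
  obtain r u where u: "strict_mono r" "norm u = 1"
    "filterlim (\<lambda>n. norm (x (r n))) at_top sequentially"
    "(\<lambda>n. x (r n) /\<^sub>R norm (x (r n))) \<longlonglongrightarrow> u"
    using ex_direction_subseq[OF fd xlim] by blast
  have "(\<lambda>n. blinfun_apply (g (r n)) (x (r n) /\<^sub>R norm (x (r n)))) \<longlonglongrightarrow> blinfun_apply f u"
    using u(4) LIMSEQ_subseq_LIMSEQ[OF glim u(1)] by (intro blinfun.tendsto) (simp_all add: o_def)
  moreover have "0 \<le> blinfun_apply (g n) (x n /\<^sub>R norm (x n))" for n
  proof -
    have "0 \<le> blinfun_apply (g n) (x n)" using x(2)[of n] by (meson of_nat_0_le_iff order_less_imp_le order_trans)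
    then show ?thesis by (simp add: blinfun.scaleR_right)
  qed
  ultimately have "0 \<le> blinfun_apply f u" by (intro LIMSEQ_le_const) auto
  moreover have "asymptotic_direction C u"
    unfolding asymptotic_direction_def using u x(1) by (intro exI[of _ "\<lambda>n. x (r n)"]) auto
  moreover have "u \<noteq> 0" using u(2) by auto
  ultimately show thesis using that by blast
qed

lemma unbounded_asymptotic_direction:
  fixes C :: "'a::real_normed_vector set"
  assumes fd: "finite B" "span B = (UNIV :: 'a set)" and C: "\<not> bounded C"
  obtains u where "asymptotic_direction C u" "u \<noteq> 0"
proof -
  have "\<exists>x\<in>C. real n < norm x" for n using C by (auto simp: bounded_iff not_le)
  then obtain x where x: "\<And>n. x n \<in> C" "\<And>n. real n < norm (x n)" by metis
  have xlim: "filterlim (\<lambda>n. norm (x n)) at_top sequentially"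
    using filterlim_real_sequentially by (rule filterlim_at_top_mono) (simp add: x less_imp_le)
  obtain r u where "strict_mono r" "norm u = 1"
    "filterlim (\<lambda>n. norm (x (r n))) at_top sequentially"
    "(\<lambda>n. x (r n) /\<^sub>R norm (x (r n))) \<longlonglongrightarrow> u"
    using ex_direction_subseq[OF fd xlim] by blast
  then have "asymptotic_direction C u" "u \<noteq> 0"
    unfolding asymptotic_direction_def using x(1) by (auto intro!: exI[of _ "\<lambda>n. x (r n)"])
  then show thesis using that by blast
qed

section \<open>From the barrier cone to strong separation\<close>

text \<open>
  Points of \<open>C\<close> and \<open>D\<close> whose distance tends to \<open>0\<close> must escape to infinity along some direction
  \<open>u\<close>. A functional separating \<open>C\<close> and \<open>D\<close> weakly is nonnegative at \<open>u\<close> because it is bounded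
  below on \<open>D\<close>, but negative at \<open>u\<close> because it is interior to the barrier cone.
\<close>

lemma strong_separation_if_barrier_cone:
  fixes C :: "'a::real_normed_vector set"
  assumes fd: "finite B" "span B = (UNIV :: 'a set)"
    and C: "C \<noteq> {}" "closed C" "convex C"
    and bar: "barrier_cone C = interior (barrier_cone C) \<union> {0}"
  shows "strong_separation_property C"
  unfolding strong_separation_property_def
proof (intro allI impI, elim conjE)
  fix D :: "'a set"
  assume D: "D \<noteq> {}" "closed D" "convex D" and disj: "C \<inter> D = {}"
  show "strongly_separated C D"
  proof (rule ccontr)
    assume nsep: "\<not> strongly_separated C D"
    have "\<exists>c\<in>C. \<exists>d\<in>D. norm (d - c) < 1 / (real n + 1)" for n
      using nsep strongly_separated_if_dist[OF fd C(1,3) D(1,3), of "1 / (real n + 1)"]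
      by (force simp: not_le)
    then obtain c d where cd: "\<And>n. c n \<in> C" "\<And>n. d n \<in> D" "\<And>n. norm (d n - c n) < 1 / (real n + 1)"
      by metis
    have "(\<lambda>n. 1 / (real n + 1)) \<longlonglongrightarrow> 0"
      using LIMSEQ_inverse_real_of_nat by (simp add: inverse_eq_divide add.commute)
    then have lim0: "(\<lambda>n. d n - c n) \<longlonglongrightarrow> 0"
      by (rule Lim_null_comparison[rotated]) (use cd(3) in \<open>auto intro!: always_eventually less_imp_le\<close>)
    have "filterlim (\<lambda>n. norm (c n)) at_top sequentially"
    proof (rule ccontr)
      \<comment> \<open>Otherwise infinitely many \<open>c n\<close> lie in one ball and accumulate
        at a point of \<open>C\<close>; the \<open>d n\<close> accumulate there too, so that point
        also lies in \<open>D\<close>.\<close>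
      assume "\<not> filterlim (\<lambda>n. norm (c n)) at_top sequentially"
      then obtain Z where "\<exists>\<^sub>F n in sequentially. norm (c n) < Z"
        by (auto simp: filterlim_at_top frequently_def not_less)
      then obtain r :: "nat \<Rightarrow> nat" where r: "strict_mono r" "\<And>n. norm (c (r n)) < Z"
        using infinite_enumerate[of "{n. norm (c n) < Z}"]
        by (auto simp: cofinite_eq_sequentially[symmetric] frequently_cofinite)
      have "compact (C \<inter> cball 0 Z)" using C(2) by (intro compact_if_span_finite[OF fd]) auto
      moreover have "\<forall>n. (c \<circ> r) n \<in> C \<inter> cball 0 Z" using cd(1) r(2) by (auto intro: less_imp_le)
      ultimately obtain l s where s: "l \<in> C \<inter> cball 0 Z" "strict_mono s" "((c \<circ> r) \<circ> s) \<longlonglongrightarrow> l"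
        unfolding compact_def by metis
      have "((\<lambda>n. (d n - c n)) \<circ> (r \<circ> s)) \<longlonglongrightarrow> 0"
        by (intro LIMSEQ_subseq_LIMSEQ[OF lim0] strict_mono_o r s)
      from tendsto_add[OF this s(3)] have "(\<lambda>n. d (r (s n))) \<longlonglongrightarrow> l" by (simp add: o_def)
      then have "l \<in> D" by (rule closed_sequentially[OF D(2) cd(2)])
      then show False using s(1) disj by blast
    qed
    then obtain r u where u: "strict_mono r" "norm u = 1"
      "filterlim (\<lambda>n. norm (c (r n))) at_top sequentially"
      "(\<lambda>n. c (r n) /\<^sub>R norm (c (r n))) \<longlonglongrightarrow> u"
      using ex_direction_subseq[OF fd] by blast
    have dir: "asymptotic_direction C u"
      unfolding asymptotic_direction_def using u cd(1) by (intro exI[of _ "\<lambda>n. c (r n)"]) auto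
    obtain f :: "'a \<Rightarrow>\<^sub>L real" where f: "f \<noteq> 0"
      "\<And>c d. c \<in> C \<Longrightarrow> d \<in> D \<Longrightarrow> blinfun_apply f c \<le> blinfun_apply f d"
      by (rule weakly_separated[OF fd C D disj]) (rule that)
    obtain d0 where "d0 \<in> D" using D(1) by blast
    then have "f \<in> barrier_cone C"
      unfolding barrier_cone_iff using f(2) by (intro exI[of _ "blinfun_apply f d0"]) blast
    then have "f \<in> interior (barrier_cone C)" using bar f(1) by blast
    then have neg: "blinfun_apply f u < 0"
      using u(2) by (intro interior_barrier_cone_direction_less[OF fd dir]) auto
    obtain c0 where c0: "c0 \<in> C" using C by blast
    \<comment> \<open>\<open>f c0 \<le> f (d n)\<close>, and passing from \<open>d n\<close> to
      \<open>c n\<close> loses at most \<open>norm f\<close> because the two points are at distance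
      at most 1.\<close>
    define m where "m = blinfun_apply f c0 - norm f"
    have ge: "blinfun_apply f (c n) \<ge> m" for n
    proof -
      have "norm (d n - c n) \<le> 1" using cd(3)[of n] by (smt (verit) divide_le_eq_1 of_nat_0_le_iff)
      then have "norm f * norm (d n - c n) \<le> norm f * 1" by (intro mult_left_mono) auto
      then have "blinfun_apply f (d n - c n) \<le> norm f" using norm_blinfun[of f "d n - c n"] by simp
      then show ?thesis using f(2)[OF c0 cd(2), of n] by (simp add: m_def blinfun.diff_right)
    qed
    have "(\<lambda>n. m / norm (c (r n))) \<longlonglongrightarrow> 0"
      using u(3) by (intro tendsto_divide_0[OF tendsto_const] filterlim_at_top_imp_at_infinity)
    moreover have "(\<lambda>n. blinfun_apply f (c (r n) /\<^sub>R norm (c (r n)))) \<longlonglongrightarrow> blinfun_apply f u"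
      using u(4) by (intro tendsto_intros)
    moreover have "m / norm (c n) \<le> blinfun_apply f (c n /\<^sub>R norm (c n))" for n
      using ge[of n] by (simp add: blinfun.scaleR_right divide_inverse mult.commute[of "inverse _"] mult_right_mono)
    ultimately have "0 \<le> blinfun_apply f u" by (meson LIMSEQ_le)
    with neg show False by simp
  qed
qed

section \<open>From strong separation to the barrier cone\<close>

text \<open>In the expanded product the cross term \<open>a * b' + a' * b\<close> is at least 2 by
  the inequality of arithmetic and geometric means, since its two summands have product at least
  1.\<close>

lemma hyperbola_convex:
  fixes a a' b b' p q :: real
  assumes n: "0 \<le> a" "0 \<le> a'" "0 \<le> b" "0 \<le> b'" "1 \<le> a * b" "1 \<le> a' * b'"
    and pq: "0 \<le> p" "0 \<le> q" "p + q = 1"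
  shows "1 \<le> (p * a + q * a') * (p * b + q * b')"
proof -
  have "1 * 1 \<le> (a * b) * (a' * b')" using n by (intro mult_mono) simp_all
  also have "\<dots> = (a * b') * (a' * b)" by (simp only: ac_simps)
  finally have prod: "1 \<le> (a * b') * (a' * b)" by simp
  have "0 \<le> a * b'" "0 \<le> a' * b" using n by simp_all
  then have "sqrt ((a * b') * (a' * b)) \<le> (a * b' + a' * b) / 2"
    by (rule arith_geo_mean_sqrt)
  moreover have "1 \<le> sqrt ((a * b') * (a' * b))" using prod by simp
  ultimately have "1 \<le> (a * b' + a' * b) / 2" by (rule order_trans[rotated])
  then have cross: "2 \<le> a * b' + a' * b" by simp
  have "1 = (p + q) * (p + q)" using pq(3) by simp
  also have "\<dots> = p * p * 1 + q * q * 1 + p * q * 2" by (simp add: algebra_simps)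
  also have "\<dots> \<le> p * p * (a * b) + q * q * (a' * b') + p * q * (a * b' + a' * b)"
    by (rule add_mono[OF add_mono]; rule mult_left_mono) (use pq n cross in simp_all)
  also have "\<dots> = (p * a + q * a') * (p * b + q * b')" by (simp add: algebra_simps)
  finally show ?thesis .
qed

text \<open>
  If a nonzero \<open>f\<close> in the barrier cone is not interior, it vanishes on some asymptotic direction
  \<open>u\<close> of \<open>C\<close>. A closed convex set at distance \<open>0\<close> from \<open>C\<close> but disjoint from it is then the
  half-space \<open>{f \<ge> sup\<^bsub>C\<^esub> f}\<close> if the supremum is not attained, and otherwise
  the region above a branch of a hyperbola with the ray in direction \<open>u\<close> as an asymptote.
\<close>

lemma barrier_cone_if_strong_separation:
  fixes C :: "'a::real_normed_vector set"
  assumes fd: "finite B" "span B = (UNIV :: 'a set)"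
    and C: "C \<noteq> {}" "closed C" "convex C"
    and ssp: "strong_separation_property C"
  shows "barrier_cone C = interior (barrier_cone C) \<union> {0}"
proof -
  have "f \<in> interior (barrier_cone C)" if f: "f \<in> barrier_cone C" "f \<noteq> 0" for f
  proof (rule ccontr)
    assume "f \<notin> interior (barrier_cone C)"
    then obtain u where u: "asymptotic_direction C u" "u \<noteq> 0" "0 \<le> blinfun_apply f u"
      using not_interior_barrier_cone_direction[OF fd] by blast
    have fu: "blinfun_apply f u = 0" using u(3) barrier_cone_direction_le[OF u(1) f(1)] by simp
    obtain w where w: "blinfun_apply f w \<noteq> 0" using f(2) by (metis blinfun_eqI zero_blinfun.rep_eq)
    define s where "s = Sup (blinfun_apply f ` C)"
    have bdd: "bdd_above (blinfun_apply f ` C)" using f(1) by (auto simp: barrier_cone_iff bdd_above_def)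
    have le_s: "blinfun_apply f c \<le> s" if "c \<in> C" for c
      unfolding s_def using that bdd by (rule cSUP_upper)
    have no_gap: False if D: "closed D" "convex D" "C \<inter> D = {}"
      and close: "\<And>e. e > 0 \<Longrightarrow> \<exists>c\<in>C. \<exists>d\<in>D. norm (d - c) < e" for D
    proof -
      have "D \<noteq> {}" using close[of 1] by auto
      then have "strongly_separated C D" using ssp D unfolding strong_separation_property_def by blast
      then obtain \<delta> where "\<delta> > 0" "\<And>c d. c \<in> C \<Longrightarrow> d \<in> D \<Longrightarrow> \<delta> \<le> norm (d - c)"
        by (rule strongly_separated_dist) (rule that)
      then show False using close[of \<delta>] by (meson not_le)
    qed
    define v where "v = w /\<^sub>R blinfun_apply f w"
    have fv: "blinfun_apply f v = 1" using w by (simp add: v_def blinfun.scaleR_right)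
    have v0: "v \<noteq> 0" using fv by auto
    show False
    proof (cases "\<exists>c0\<in>C. blinfun_apply f c0 = s")
      case False
      show False
      proof (rule no_gap)
        show "closed {x. s \<le> blinfun_apply f x}" by (intro closed_Collect_le continuous_intros)
        show "convex {x. s \<le> blinfun_apply f x}"
          using convex_linear_vimage[OF bounded_linear.linear[OF blinfun.bounded_linear_right],
              OF convex_real_interval(1), of f s] by (simp add: vimage_def)
        show "C \<inter> {x. s \<le> blinfun_apply f x} = {}" using False le_s by force
        fix e :: real assume e: "e > 0"
        \<comment> \<open>Moving along \<open>v\<close> raises \<open>f\<close> at unit rate, so a
          point of \<open>C\<close> whose deficit from \<open>s\<close> is below
          \<open>e / norm v\<close> reaches the half-space by a step shorter than
          \<open>e\<close>.\<close>
        then have "s - e / norm v < s" using v0 by simp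
        then obtain c where c: "c \<in> C" "s - e / norm v < blinfun_apply f c"
          using C(1) bdd less_cSUP_iff[of C "blinfun_apply f"] unfolding s_def by blast
        have "c + (s - blinfun_apply f c) *\<^sub>R v \<in> {x. s \<le> blinfun_apply f x}"
          using fv by (simp add: blinfun.add_right blinfun.scaleR_right)
        moreover have "(s - blinfun_apply f c) * norm v < e"
        proof -
          have "s - blinfun_apply f c < e / norm v" using c(2) by linarith
          then show ?thesis by (rule iffD1[OF pos_less_divide_eq, rotated]) (simp add: v0)
        qed
        then have "norm (c + (s - blinfun_apply f c) *\<^sub>R v - c) < e"
          using le_s[OF c(1)] by simp
        ultimately show "\<exists>c\<in>C. \<exists>d\<in>{x. s \<le> blinfun_apply f x}. norm (d - c) < e"
          using c(1) by (intro bexI)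
      qed
    next
      case True
      then obtain c0 where c0: "c0 \<in> C" "blinfun_apply f c0 = s" by blast
      obtain \<Phi> :: "('a \<Rightarrow>\<^sub>L real) set" where \<Phi>: "coordinates \<Phi>" using ex_coordinates[OF fd] by blast
      \<comment> \<open>\<open>h\<close> measures the component along \<open>u\<close>, where
        \<open>f\<close> vanishes; together they act as plane coordinates with origin
        \<open>c0\<close>, in which the hyperbola is drawn.\<close>
      define h where "h = gram \<Phi> u /\<^sub>R blinfun_apply (gram \<Phi> u) u"
      have hu: "blinfun_apply h u = 1"
        using gram_pos[OF \<Phi> u(2)] by (simp add: h_def blinfun.scaleR_left)
      let ?F = "\<lambda>x. blinfun_apply f (x - c0)" and ?h = "\<lambda>x. blinfun_apply h (x - c0)"
      define D where "D = {x. 0 \<le> ?F x \<and> 0 \<le> ?h x \<and> 1 \<le> ?F x * ?h x}"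
      \<comment> \<open>Removing the \<open>u\<close>-component gives \<open>v'\<close> the
        coordinates \<open>(1, 0)\<close>, while \<open>u\<close> has \<open>(0, 1)\<close>; so
        \<open>c0 + t *\<^sub>R u + (1 / t) *\<^sub>R v'\<close> lies on the hyperbola.\<close>
      define v' where "v' = v - blinfun_apply h v *\<^sub>R u"
      have fv': "blinfun_apply f v' = 1" and hv': "blinfun_apply h v' = 0"
        using fv fu hu by (simp_all add: v'_def blinfun.diff_right blinfun.scaleR_right)
      show False
      proof (rule no_gap)
        show "closed D" unfolding D_def
          by (intro closed_Collect_conj closed_Collect_le continuous_intros)
        show "convex D"
        proof (rule convexI)
          fix x y and p q :: real
          assume x: "x \<in> D" and y: "y \<in> D" and pq: "0 \<le> p" "0 \<le> q" "p + q = 1"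
          have "p *\<^sub>R x + q *\<^sub>R y - c0 = p *\<^sub>R x + q *\<^sub>R y - (p + q) *\<^sub>R c0"
            using pq(3) by simp
          also have "\<dots> = p *\<^sub>R (x - c0) + q *\<^sub>R (y - c0)" by (simp add: algebra_simps)
          finally have comb: "p *\<^sub>R x + q *\<^sub>R y - c0 = p *\<^sub>R (x - c0) + q *\<^sub>R (y - c0)" .
          have eq: "blinfun_apply g (p *\<^sub>R x + q *\<^sub>R y - c0)
              = p * blinfun_apply g (x - c0) + q * blinfun_apply g (y - c0)" for g :: "'a \<Rightarrow>\<^sub>L real"
            unfolding comb by (simp only: blinfun.add_right blinfun.scaleR_right real_scaleR_def)
          have "0 \<le> p * ?F x + q * ?F y" "0 \<le> p * ?h x + q * ?h y"
            "1 \<le> (p * ?F x + q * ?F y) * (p * ?h x + q * ?h y)"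
            using x y pq by (auto simp: D_def intro!: hyperbola_convex)
          then show "p *\<^sub>R x + q *\<^sub>R y \<in> D" unfolding D_def mem_Collect_eq eq by (intro conjI)
        qed
        show "C \<inter> D = {}"
        proof -
          have "x \<notin> D" if "x \<in> C" for x
          proof
            assume x: "x \<in> D"
            \<comment> \<open>\<open>f\<close> is at most \<open>s = f c0\<close> on
              \<open>C\<close>, so a common point would have \<open>?F x = 0\<close>, against
              \<open>1 \<le> ?F x * ?h x\<close>.\<close>
            have "?F x = 0" using x le_s[OF that] c0 by (simp add: D_def blinfun.diff_right)
            with x show False by (simp add: D_def)
          qed
          then show ?thesis by blast
        qed
        fix e :: real assume e: "e > 0"
        \<comment> \<open>The distance to the ray at parameter \<open>t\<close> is
          \<open>norm v' / t\<close>; the added 1 brings it strictly below \<open>e\<close>.\<close>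
        define t where "t = (norm v' + 1) / e"
        have t: "t > 0" using e by (simp add: t_def add_nonneg_pos)
        define d where "d = c0 + t *\<^sub>R u + (1 / t) *\<^sub>R v'"
        have "?F d = 1 / t" "?h d = t"
          using fu hu fv' hv' by (simp_all add: d_def blinfun.add_right blinfun.diff_right blinfun.scaleR_right)
        then have "d \<in> D" using t by (simp add: D_def)
        moreover have "c0 + t *\<^sub>R u \<in> C"
          using asymptotic_direction_add_mem[OF C(2,3) u(1) c0(1)] t by simp
        moreover have "norm (d - (c0 + t *\<^sub>R u)) = norm v' / t" using t by (simp add: d_def)
        moreover have "norm v' / t < e"
        proof -
          have "e * t = norm v' + 1" using e by (simp add: t_def)
          then have "norm v' < e * t" by linarith
          then show ?thesis using t by (simp add: divide_less_eq)
        qed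
        ultimately show "\<exists>c\<in>C. \<exists>d\<in>D. norm (d - c) < e" by (intro bexI) simp_all
      qed
    qed
  qed
  moreover have "0 \<in> barrier_cone C" by (auto simp: barrier_cone_iff)
  ultimately show ?thesis using interior_subset by blast
qed

theorem corollary4:
  fixes C :: "'a::real_normed_vector set"
  assumes finite_dim: "\<exists>B::'a set. finite B \<and> span B = UNIV"
    and "C \<noteq> {}" and "closed C" and "convex C"
  shows "(strong_separation_property C \<longleftrightarrow>
            barrier_cone C = interior (barrier_cone C) \<union> {0})
       \<and> (\<not> bounded C \<and> strong_separation_property C \<longrightarrow> interior C \<noteq> {})"
proof -
  obtain B :: "'a set" where fd: "finite B" "span B = (UNIV :: 'a set)" using finite_dim by blast
  note C = assms(2-4)
  have "interior C \<noteq> {}" if unb: "\<not> bounded C" and ssp: "strong_separation_property C"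
  proof -
    obtain u where u: "asymptotic_direction C u" "u \<noteq> 0"
      using unbounded_asymptotic_direction[OF fd unb] by blast
    obtain c0 where c0: "c0 \<in> C" using C by blast
    have c1: "c0 + u \<in> C" using asymptotic_direction_add_mem[OF C(2,3) u(1) c0, of 1] by simp
    have "c0 + u \<in> interior C"
    proof (rule ccontr)
      assume "c0 + u \<notin> interior C"
      then obtain f :: "'a \<Rightarrow>\<^sub>L real" where f: "f \<noteq> 0"
        "\<And>x. x \<in> C \<Longrightarrow> blinfun_apply f x \<le> blinfun_apply f (c0 + u)"
        by (rule supporting_functional[OF fd C(2,3) c1]) (rule that)
      \<comment> \<open>Support at a point bounds \<open>f\<close> on \<open>C\<close>. Being
        nonzero, \<open>f\<close> is then interior by the characterisation of the property, hence
        negative at \<open>u\<close>, against the sign forced by comparing \<open>c0\<close> with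
        \<open>c0 + u\<close>.\<close>
      have "f \<in> barrier_cone C" using f(2) by (auto simp: barrier_cone_iff)
      then have "f \<in> interior (barrier_cone C)"
        using barrier_cone_if_strong_separation[OF fd C ssp] f(1) by blast
      then have "blinfun_apply f u < 0" by (rule interior_barrier_cone_direction_less[OF fd u])
      with f(2)[OF c0] show False by (simp add: blinfun.add_right)
    qed
    then show ?thesis by blast
  qed
  then show ?thesis
    using strong_separation_if_barrier_cone[OF fd C] barrier_cone_if_strong_separation[OF fd C] by blast
qed

end
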